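(* Let $G=(\mathbb{Z}_2)^2 \wr \mathbb{Z}$ be the restricted wreath product, where $\mathbb{Z}_2$ is the cyclic group of order $2$. Then $G$ satisfies property (LR), but there exists a group $\tilde G$ containing $G$ as a subgroup of index $2$ such that $\tilde G$ does not satisfy property (LR).
   Context: A subgroup $H$ of a group $K$ is a retract of $K$ if there is a homomorphism $\rho: K \to H$ which restricts to the identity map on $H$. A subgroup $H$ of a group $G$ is a virtual retract of $G$ if there exists a subgroup $K \leqslant G$ with $|G:K|<\infty$, $H \subseteq K$, and $H$ a retract of $K$. A group $G$ has property (LR) if every finitely generated subgroup of $G$ is a virtual retract of $G$. For groups $A,B$, the restricted wreath product $A\wr B$ is the semidirect product $A^B\rtimes B$, where $A^B$ is the group of all functions $f:B\to A$ with finite support under pointwise multiplication, and $b\in B$ acts by $(bfb^{-1})(x)=f(xb)$ for all $x\in B$. *)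

theory Defs
  imports "HOL-Algebra.Algebra"
begin

(* In this theory the group axioms are never part of a definition: group G is to be assumed or
   proved separately. The index |G : K| is the number of right cosets. *)

definition finitely_generated_subgroup :: "'a set \<Rightarrow> ('a, 'm) monoid_scheme \<Rightarrow> bool" where
  "finitely_generated_subgroup H G \<longleftrightarrow> (\<exists>S. finite S \<and> S \<subseteq> carrier G \<and> H = generate G S)"

definition group_retract :: "'a set \<Rightarrow> ('a, 'm) monoid_scheme \<Rightarrow> bool" where
  "group_retract H K \<longleftrightarrow>
     subgroup H K \<and> (\<exists>\<rho> \<in> hom K (K\<lparr>carrier := H\<rparr>). \<forall>h\<in>H. \<rho> h = h)"

definition virtual_retract :: "'a set \<Rightarrow> ('a, 'm) monoid_scheme \<Rightarrow> bool" where
  "virtual_retract H G \<longleftrightarrow>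
     subgroup H G \<and>
     (\<exists>K. subgroup K G \<and> finite (rcosets\<^bsub>G\<^esub> K) \<and> H \<subseteq> K \<and> group_retract H (G\<lparr>carrier := K\<rparr>))"

definition property_LR :: "('a, 'm) monoid_scheme \<Rightarrow> bool" where
  "property_LR G \<longleftrightarrow> (\<forall>H. finitely_generated_subgroup H G \<longrightarrow> virtual_retract H G)"

(* The action is written n \<mapsto> h n h^-1, so (n h)(n' h') = n (h n' h^-1) h h'. *)
definition semidirect_product ::
  "('a, 'm) monoid_scheme \<Rightarrow> ('b, 'n) monoid_scheme \<Rightarrow> ('b \<Rightarrow> 'a \<Rightarrow> 'a) \<Rightarrow> ('a \<times> 'b) monoid" where
  "semidirect_product N H \<phi> =
     \<lparr>carrier = carrier N \<times> carrier H,
      monoid.mult = (\<lambda>(n, h) (n', h'). (n \<otimes>\<^bsub>N\<^esub> \<phi> h n', h \<otimes>\<^bsub>H\<^esub> h')),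
      one = (\<one>\<^bsub>N\<^esub>, \<one>\<^bsub>H\<^esub>)\<rparr>"

(* sum_group consists of the finitely supported functions, extensional outside carrier B;
   see carrier_wreath_base. *)
definition wreath_base ::
  "('a, 'm) monoid_scheme \<Rightarrow> ('b, 'n) monoid_scheme \<Rightarrow> ('b \<Rightarrow> 'a) monoid" where
  "wreath_base A B = sum_group (carrier B) (\<lambda>_. A)"

(* (b f b^-1)(x) = f (x b): translation on the right gives a left action of B. *)
definition wreath_action :: "('b, 'n) monoid_scheme \<Rightarrow> 'b \<Rightarrow> ('b \<Rightarrow> 'a) \<Rightarrow> ('b \<Rightarrow> 'a)" where
  "wreath_action B b f = (\<lambda>x\<in>carrier B. f (x \<otimes>\<^bsub>B\<^esub> b))"

definition restricted_wreath ::
  "('a, 'm) monoid_scheme \<Rightarrow> ('b, 'n) monoid_scheme \<Rightarrow> (('b \<Rightarrow> 'a) \<times> 'b) monoid" where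
  "restricted_wreath A B = semidirect_product (wreath_base A B) B (wreath_action B)"

lemma carrier_wreath_base:
  assumes "group A"
  shows "carrier (wreath_base A B) =
    {f \<in> carrier B \<rightarrow>\<^sub>E carrier A. finite {x \<in> carrier B. f x \<noteq> \<one>\<^bsub>A\<^esub>}}"
  unfolding wreath_base_def by (rule carrier_sum_group) (use assms in auto)

lemma group_semidirect_product:
  assumes N: "group N" and H: "group H"
    and \<phi>: "\<And>h. h \<in> carrier H \<Longrightarrow> \<phi> h \<in> hom N N"
    and one: "\<And>n. n \<in> carrier N \<Longrightarrow> \<phi> \<one>\<^bsub>H\<^esub> n = n"
    and mult: "\<And>h h' n. \<lbrakk>h \<in> carrier H; h' \<in> carrier H; n \<in> carrier N\<rbrakk>
      \<Longrightarrow> \<phi> (h \<otimes>\<^bsub>H\<^esub> h') n = \<phi> h (\<phi> h' n)"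
  shows "group (semidirect_product N H \<phi>)"
proof -
  interpret N: group N by fact
  interpret H: group H by fact
  have cl: "\<phi> h n \<in> carrier N" if "h \<in> carrier H" "n \<in> carrier N" for h n
    using \<phi>[OF that(1)] that(2) by (auto simp: hom_def)
  have hm: "\<phi> h (n \<otimes>\<^bsub>N\<^esub> n') = \<phi> h n \<otimes>\<^bsub>N\<^esub> \<phi> h n'"
    if "h \<in> carrier H" "n \<in> carrier N" "n' \<in> carrier N" for h n n'
    using \<phi>[OF that(1)] that(2,3) by (auto simp: hom_def)
  have h1: "\<phi> h \<one>\<^bsub>N\<^esub> = \<one>\<^bsub>N\<^esub>" if "h \<in> carrier H" for h
    using hm[OF that N.one_closed N.one_closed] cl[OF that N.one_closed]
    by (metis N.l_cancel_one N.l_one N.one_closed)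
  show ?thesis
  proof (rule groupI)
    fix x assume x: "x \<in> carrier (semidirect_product N H \<phi>)"
    obtain n h where nh: "x = (n, h)" "n \<in> carrier N" "h \<in> carrier H"
      using x by (auto simp: semidirect_product_def)
    let ?y = "(\<phi> (inv\<^bsub>H\<^esub> h) (inv\<^bsub>N\<^esub> n), inv\<^bsub>H\<^esub> h)"
    have "\<phi> (inv\<^bsub>H\<^esub> h) (inv\<^bsub>N\<^esub> n) \<otimes>\<^bsub>N\<^esub> \<phi> (inv\<^bsub>H\<^esub> h) n = \<one>\<^bsub>N\<^esub>"
      using nh by (simp flip: hm add: h1)
    then show "\<exists>y\<in>carrier (semidirect_product N H \<phi>).
        y \<otimes>\<^bsub>semidirect_product N H \<phi>\<^esub> x = \<one>\<^bsub>semidirect_product N H \<phi>\<^esub>"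
      using nh cl by (intro bexI[of _ ?y]) (auto simp: semidirect_product_def)
  qed (auto simp: semidirect_product_def cl hm one mult N.m_assoc H.m_assoc)
qed

lemma group_restricted_wreath:
  fixes A :: "('a, 'm) monoid_scheme" and B :: "('b, 'n) monoid_scheme"
  assumes A: "group A" and B: "group B"
  shows "group (restricted_wreath A B)"
  unfolding restricted_wreath_def
proof (rule group_semidirect_product)
  interpret A: group A by fact
  interpret B: group B by fact
  show "group (wreath_base A B)"
    unfolding wreath_base_def by (simp add: A)
  show "group B" by fact
  have fin: "finite {x \<in> carrier B. f (x \<otimes>\<^bsub>B\<^esub> b) \<noteq> \<one>\<^bsub>A\<^esub>}"
    if b: "b \<in> carrier B" and f: "finite {x \<in> carrier B. f x \<noteq> \<one>\<^bsub>A\<^esub>}" for b and f :: "'b \<Rightarrow> 'a"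
  proof -
    have "inj_on (\<lambda>x. x \<otimes>\<^bsub>B\<^esub> b) {x \<in> carrier B. f (x \<otimes>\<^bsub>B\<^esub> b) \<noteq> \<one>\<^bsub>A\<^esub>}"
      using b by (auto simp: inj_on_def)
    moreover have "(\<lambda>x. x \<otimes>\<^bsub>B\<^esub> b) ` {x \<in> carrier B. f (x \<otimes>\<^bsub>B\<^esub> b) \<noteq> \<one>\<^bsub>A\<^esub>}
        \<subseteq> {x \<in> carrier B. f x \<noteq> \<one>\<^bsub>A\<^esub>}"
      using b by auto
    ultimately show ?thesis
      using f by (meson finite_imageD finite_subset)
  qed
  show "wreath_action B b \<in> hom (wreath_base A B) (wreath_base A B)" if b: "b \<in> carrier B" for b
  proof (rule homI)
    fix f assume "f \<in> carrier (wreath_base A B)"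
    then show "wreath_action B b f \<in> carrier (wreath_base A B)"
      using fin[OF b, of f] b
      by (auto simp: carrier_wreath_base[OF A] wreath_action_def PiE_iff cong: conj_cong)
  next
    fix f g assume "f \<in> carrier (wreath_base A B)" "g \<in> carrier (wreath_base A B)"
    then show "wreath_action B b (f \<otimes>\<^bsub>wreath_base A B\<^esub> g) =
        wreath_action B b f \<otimes>\<^bsub>wreath_base A B\<^esub> wreath_action B b g"
      using b by (auto simp: wreath_base_def wreath_action_def fun_eq_iff)
  qed
  show "wreath_action B \<one>\<^bsub>B\<^esub> f = f" if "f \<in> carrier (wreath_base A B)" for f
    using that by (auto simp: carrier_wreath_base[OF A] wreath_action_def fun_eq_iff PiE_iff extensional_def)
  show "wreath_action B (b \<otimes>\<^bsub>B\<^esub> c) f = wreath_action B b (wreath_action B c f)"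
    if "b \<in> carrier B" "c \<in> carrier B" for b c and f :: "'b \<Rightarrow> 'a"
    using that by (auto simp: wreath_action_def fun_eq_iff B.m_assoc)
qed

end

theory Submission
  imports Defs
begin

text \<open>Interleaving the two coordinates embeds \<open>G\<close> into the lamplighter group, and (LR) passes to
  subgroups. A finitely generated subgroup \<open>H\<close> of the lamplighter group either consists of finitely
  many lamp configurations or projects onto \<open>m\<int>\<close> with \<open>m > 0\<close>. In both cases a normal complement of
  \<open>H\<close> in a subgroup of finite index is obtained from a coordinate subspace, which is chosen maximal
  among those that meet the lamp part of \<open>H\<close> trivially.

  Let \<open>x\<close> be the involution that swaps the two coordinates, in the extension of \<open>G\<close> by \<open>x\<close>. The
  subgroup \<open>H\<close> generated by \<open>x\<close>, the translation and the lamp \<open>(1, 1)\<close> at 0 centralises \<open>x\<close> and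
  contains all commutators \<open>[x, z]\<close> with \<open>z\<close> a lamp configuration. A retraction onto \<open>H\<close> fixes these
  commutators but also maps them to commutators of \<open>x\<close> with elements of \<open>H\<close>, which are trivial. So
  its domain contains only those \<open>z\<close> that commute with \<open>x\<close>, and cannot have finite index.\<close>

section \<open>Virtual retracts\<close>

text \<open>\<open>H\<close> normalises \<open>N\<close> and meets it trivially, so
  \<open>K = H N\<close> is a semidirect product, and projection to the \<open>H\<close>-factor is a
  retraction. Each right coset of \<open>K\<close> has the form \<open>K #> t\<close> with
  \<open>t\<close> in \<open>T\<close>.\<close>

lemma (in group) virtual_retractI_complement:
  assumes H: "subgroup H G" and N: "subgroup N G"
    and norm: "\<And>h n. \<lbrakk>h \<in> H; n \<in> N\<rbrakk> \<Longrightarrow> h \<otimes> n \<otimes> inv h \<in> N"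
    and disj: "H \<inter> N \<subseteq> {\<one>}"
    and T: "finite T" "T \<subseteq> carrier G"
    and cover: "\<And>x. x \<in> carrier G \<Longrightarrow> \<exists>h\<in>H. \<exists>n\<in>N. \<exists>t\<in>T. x = h \<otimes> n \<otimes> t"
  shows "virtual_retract H G"
proof -
  interpret H: subgroup H G by fact
  interpret N: subgroup N G by fact
  define K where "K = {h \<otimes> n | h n. h \<in> H \<and> n \<in> N}"
  have KI: "h \<otimes> n \<in> K" if "h \<in> H" "n \<in> N" for h n
    using that by (auto simp: K_def)
  \<comment> \<open>Moving \<open>n\<close> past \<open>h'\<close> conjugates it, which by
    \<open>norm'\<close> keeps it in \<open>N\<close>. This yields both closure of \<open>K\<close>
    and multiplicativity of \<open>\<rho>\<close>.\<close>
  have prod: "(h \<otimes> n) \<otimes> (h' \<otimes> n') = (h \<otimes> h') \<otimes> ((inv h' \<otimes> n \<otimes> h') \<otimes> n')"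
    if "h \<in> carrier G" "n \<in> carrier G" "h' \<in> carrier G" "n' \<in> carrier G" for h n h' n'
  proof -
    have "h' \<otimes> (inv h' \<otimes> n \<otimes> h') = n \<otimes> h'" using that by (simp flip: m_assoc)
    then show ?thesis using that by (metis inv_closed m_assoc m_closed)
  qed
  have norm': "inv h \<otimes> n \<otimes> h \<in> N" if "h \<in> H" "n \<in> N" for h n
    using norm[of "inv h" n] that by simp
  have uniq: "h = h'" if "h \<in> H" "n \<in> N" "h' \<in> H" "n' \<in> N" "h \<otimes> n = h' \<otimes> n'" for h n h' n'
  proof -
    have "inv h' \<otimes> h = n' \<otimes> inv n"
      using that
      by (metis H.mem_carrier N.mem_carrier inv_closed inv_solve_left inv_solve_right m_assoc m_closed)
    moreover have "inv h' \<otimes> h \<in> H" "n' \<otimes> inv n \<in> N" using that by auto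
    ultimately have "inv h' \<otimes> h = \<one>" using disj by auto
    then show ?thesis using that by (metis H.mem_carrier inv_closed inv_equality inv_inv)
  qed
  have K: "subgroup K G"
  proof (rule subgroupI)
    show "K \<subseteq> carrier G" by (auto simp: K_def)
    show "K \<noteq> {}" using KI[OF H.one_closed N.one_closed] by auto
    fix a assume "a \<in> K"
    then obtain h n where a: "a = h \<otimes> n" "h \<in> H" "n \<in> N" by (auto simp: K_def)
    have "inv a = inv h \<otimes> (h \<otimes> inv n \<otimes> inv h)"
      using a by (simp add: inv_mult_group flip: m_assoc)
    then show "inv a \<in> K" using a norm KI by simp
    fix b assume "b \<in> K"
    then obtain h' n' where b: "b = h' \<otimes> n'" "h' \<in> H" "n' \<in> N" by (auto simp: K_def)
    show "a \<otimes> b \<in> K" unfolding a b using a b by (subst prod) (auto intro!: KI norm')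
  qed
  define \<rho> where "\<rho> k = (THE h. h \<in> H \<and> (\<exists>n\<in>N. k = h \<otimes> n))" for k
  have \<rho>: "\<rho> (h \<otimes> n) = h" if "h \<in> H" "n \<in> N" for h n
    unfolding \<rho>_def using that uniq by (intro the_equality) auto
  have HK: "H \<subseteq> K" using KI[OF _ N.one_closed] by auto
  have "\<rho> \<in> hom (G\<lparr>carrier := K\<rparr>) (G\<lparr>carrier := H\<rparr>)"
  proof (rule homI)
    fix a b assume "a \<in> carrier (G\<lparr>carrier := K\<rparr>)" "b \<in> carrier (G\<lparr>carrier := K\<rparr>)"
    then obtain h n h' n' where "a = h \<otimes> n" "h \<in> H" "n \<in> N" "b = h' \<otimes> n'" "h' \<in> H" "n' \<in> N"
      by (auto simp: K_def)
    then show "\<rho> (a \<otimes>\<^bsub>G\<lparr>carrier := K\<rparr>\<^esub> b) = \<rho> a \<otimes>\<^bsub>G\<lparr>carrier := H\<rparr>\<^esub> \<rho> b"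
      using prod[of h n h' n'] by (simp add: \<rho> norm' del: m_assoc)
  qed (auto simp: K_def \<rho>)
  moreover have "\<forall>h\<in>H. \<rho> h = h" using \<rho>[OF _ N.one_closed] by auto
  moreover have "subgroup H (G\<lparr>carrier := K\<rparr>)" by (rule subgroup_incl[OF H K HK])
  ultimately have "group_retract H (G\<lparr>carrier := K\<rparr>)" unfolding group_retract_def by auto
  moreover have "rcosets K \<subseteq> (\<lambda>t. K #> t) ` T"
  proof
    fix c assume "c \<in> rcosets K"
    then obtain x where x: "x \<in> carrier G" "c = K #> x" by (auto simp: RCOSETS_def)
    obtain h n t where ht: "h \<in> H" "n \<in> N" "t \<in> T" "x = h \<otimes> n \<otimes> t" using cover[OF x(1)] by auto
    have "x \<in> K #> t" using ht KI by (auto simp: r_coset_def)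
    then have "K #> t = K #> x" using repr_independence K ht T by blast
    then show "c \<in> (\<lambda>t. K #> t) ` T" using x ht by auto
  qed
  then have "finite (rcosets K)" using T finite_surj by blast
  ultimately show ?thesis unfolding virtual_retract_def using H K HK by blast
qed

text \<open>Everything is pulled back along the embedding: the retraction is \<open>\<phi>\<close>,
  then the retraction in \<open>G'\<close>, then the inverse of \<open>\<phi>\<close>, and its
  domain is the preimage of \<open>K'\<close>.\<close>

lemma property_LR_inj_hom:
  assumes G: "group G" and G': "group G'" and \<phi>: "\<phi> \<in> hom G G'" and inj: "inj_on \<phi> (carrier G)"
    and LR: "property_LR G'"
  shows "property_LR G"
  unfolding property_LR_def
proof (intro allI impI)
  interpret group_hom G G' \<phi> using G G' \<phi> by (simp add: group_hom_def group_hom_axioms_def)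
  fix H assume "finitely_generated_subgroup H G"
  then obtain S where S: "finite S" "S \<subseteq> carrier G" "H = generate G S"
    by (auto simp: finitely_generated_subgroup_def)
  have H: "subgroup H G" using S G.generate_is_subgroup by simp
  have Hc: "H \<subseteq> carrier G" using H by (rule subgroup.subset)
  have "\<phi> ` H = generate G' (\<phi> ` S)" using S generate_img by simp
  moreover have "finite (\<phi> ` S)" "\<phi> ` S \<subseteq> carrier G'" using S by auto
  ultimately have "finitely_generated_subgroup (\<phi> ` H) G'"
    unfolding finitely_generated_subgroup_def by blast
  then have "virtual_retract (\<phi> ` H) G'" using LR by (simp add: property_LR_def)
  then obtain K' \<rho> where K': "subgroup K' G'" "finite (rcosets\<^bsub>G'\<^esub> K')" "\<phi> ` H \<subseteq> K'"
    and \<rho>: "\<rho> \<in> hom (G'\<lparr>carrier := K'\<rparr>) (G'\<lparr>carrier := \<phi> ` H\<rparr>)" "\<forall>h\<in>\<phi> ` H. \<rho> h = h"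
    unfolding virtual_retract_def group_retract_def by auto
  interpret K': subgroup K' G' by fact
  define K where "K = {x \<in> carrier G. \<phi> x \<in> K'}"
  have K: "subgroup K G" by (rule G.subgroupI) (auto simp: K_def intro: exI[of _ "\<one>\<^bsub>G\<^esub>"])
  have HK: "H \<subseteq> K" using K' Hc by (auto simp: K_def)
  have fin: "finite (rcosets\<^bsub>G\<^esub> K)"
  proof -
    let ?F = "\<lambda>x. K' #>\<^bsub>G'\<^esub> \<phi> x"
    \<comment> \<open>Each right coset of \<open>K\<close> is the full preimage of a right coset of
      \<open>K'\<close>, so the index cannot grow.\<close>
    have eq: "K #>\<^bsub>G\<^esub> x = {y \<in> carrier G. \<phi> y \<in> ?F x}" if "x \<in> carrier G" for x
    proof -
      have "y \<in> K #>\<^bsub>G\<^esub> x \<longleftrightarrow> y \<otimes>\<^bsub>G\<^esub> inv\<^bsub>G\<^esub> x \<in> K" if "y \<in> carrier G" for y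
        using subgroup.rcos_module[OF K G \<open>x \<in> carrier G\<close> that] .
      moreover have "\<phi> y \<in> ?F x \<longleftrightarrow> \<phi> y \<otimes>\<^bsub>G'\<^esub> inv\<^bsub>G'\<^esub> \<phi> x \<in> K'" if "y \<in> carrier G" for y
        using K' \<open>x \<in> carrier G\<close> that subgroup.rcos_module[OF K'(1) G'] by simp
      moreover have "K #>\<^bsub>G\<^esub> x \<subseteq> carrier G" using that by (auto simp: r_coset_def K_def)
      ultimately show ?thesis using that by (auto simp: K_def)
    qed
    have "rcosets\<^bsub>G\<^esub> K \<subseteq> (\<lambda>c. {y \<in> carrier G. \<phi> y \<in> c}) ` (rcosets\<^bsub>G'\<^esub> K')"
    proof
      fix c assume "c \<in> rcosets\<^bsub>G\<^esub> K"
      then obtain x where x: "x \<in> carrier G" "c = K #>\<^bsub>G\<^esub> x" by (auto simp: RCOSETS_def)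
      moreover have "?F x \<in> rcosets\<^bsub>G'\<^esub> K'" using x(1) by (auto simp: RCOSETS_def)
      ultimately show "c \<in> (\<lambda>c. {y \<in> carrier G. \<phi> y \<in> c}) ` (rcosets\<^bsub>G'\<^esub> K')"
        unfolding x(2) eq[OF x(1)] by (rule_tac image_eqI) auto
    qed
    then show ?thesis using K'(2) finite_surj by blast
  qed
  \<comment> \<open>For \<open>x\<close> in \<open>K\<close> the value
    \<open>\<rho> (\<phi> x)\<close> lies in the image of \<open>H\<close>, so by injectivity its
    only preimage is an element of \<open>H\<close>.\<close>
  define \<sigma> where "\<sigma> x = inv_into (carrier G) \<phi> (\<rho> (\<phi> x))" for x
  have \<sigma>: "\<sigma> x \<in> H" "\<phi> (\<sigma> x) = \<rho> (\<phi> x)" if "x \<in> K" for x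
  proof -
    have "\<rho> (\<phi> x) \<in> \<phi> ` H" using \<rho>(1) that by (auto simp: hom_def K_def)
    then obtain h where "h \<in> H" "\<rho> (\<phi> x) = \<phi> h" by auto
    then show "\<sigma> x \<in> H" "\<phi> (\<sigma> x) = \<rho> (\<phi> x)" using inj Hc by (auto simp: \<sigma>_def)
  qed
  have "\<sigma> \<in> hom (G\<lparr>carrier := K\<rparr>) (G\<lparr>carrier := H\<rparr>)"
  proof (rule homI)
    fix x y assume "x \<in> carrier (G\<lparr>carrier := K\<rparr>)" "y \<in> carrier (G\<lparr>carrier := K\<rparr>)"
    then have xy: "x \<in> K" "y \<in> K" by auto
    then have xyK: "x \<otimes>\<^bsub>G\<^esub> y \<in> K" using K subgroup.m_closed by metis
    have c: "\<sigma> x \<in> carrier G" "\<sigma> y \<in> carrier G" "\<sigma> (x \<otimes>\<^bsub>G\<^esub> y) \<in> carrier G"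
      using \<sigma>(1) xy xyK Hc by auto
    have "\<phi> (\<sigma> (x \<otimes>\<^bsub>G\<^esub> y)) = \<phi> (\<sigma> x \<otimes>\<^bsub>G\<^esub> \<sigma> y)"
      using xy xyK c \<rho>(1) by (simp add: \<sigma>) (simp add: K_def hom_def)
    from inj_onD[OF inj this c(3) G.m_closed[OF c(1,2)]]
    show "\<sigma> (x \<otimes>\<^bsub>G\<lparr>carrier := K\<rparr>\<^esub> y) = \<sigma> x \<otimes>\<^bsub>G\<lparr>carrier := H\<rparr>\<^esub> \<sigma> y"
      by simp
  qed (use \<sigma> in auto)
  moreover have "\<forall>h\<in>H. \<sigma> h = h" using \<rho>(2) Hc inj by (auto simp: \<sigma>_def)
  ultimately have "group_retract H (G\<lparr>carrier := K\<rparr>)"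
    using G.subgroup_incl[OF H K HK] unfolding group_retract_def by auto
  then show "virtual_retract H G"
    unfolding virtual_retract_def using H K HK fin by blast
qed

text \<open>The infinitely many \<open>z k\<close> fall into finitely many cosets of the domain
  \<open>K\<close> of a retraction, so some quotient \<open>w\<close> of two of them lies in
  \<open>K\<close>. Assumption \<open>comm\<close> puts the commutator of \<open>x\<close> and
  \<open>w\<close> into \<open>H\<close>, written with as few inverses as possible.\<close>

lemma (in group) not_virtual_retract_if_commutators:
  fixes z :: "int \<Rightarrow> 'a"
  assumes x: "x \<in> H" and central: "\<And>h. h \<in> H \<Longrightarrow> x \<otimes> h = h \<otimes> x"
    and z: "\<And>k. z k \<in> carrier G"
    and comm: "\<And>k l. \<exists>h\<in>H. x \<otimes> (z k \<otimes> inv (z l)) = h \<otimes> ((z k \<otimes> inv (z l)) \<otimes> x)"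
    and nontriv: "\<And>k l. k \<noteq> l \<Longrightarrow> x \<otimes> (z k \<otimes> inv (z l)) \<noteq> (z k \<otimes> inv (z l)) \<otimes> x"
  shows "\<not> virtual_retract H G"
proof
  assume "virtual_retract H G"
  then obtain K \<rho> where H: "subgroup H G" and K: "subgroup K G" "finite (rcosets K)" "H \<subseteq> K"
    and \<rho>: "\<rho> \<in> hom (G\<lparr>carrier := K\<rparr>) (G\<lparr>carrier := H\<rparr>)" "\<forall>h\<in>H. \<rho> h = h"
    unfolding virtual_retract_def group_retract_def by auto
  interpret H: subgroup H G by fact
  interpret K: subgroup K G by fact
  have "range (\<lambda>k. K #> z k) \<subseteq> rcosets K" using z by (auto simp: RCOSETS_def)
  then have "finite (range (\<lambda>k. K #> z k))" using K(2) finite_subset by blast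
  then have "\<not> inj (\<lambda>k. K #> z k)" using finite_imageD infinite_UNIV_int by blast
  then obtain k l where kl: "k \<noteq> l" "K #> z k = K #> z l" by (auto simp: inj_def)
  define w where "w = z k \<otimes> inv (z l)"
  have "z k \<in> K #> z l" using kl(2) z K(1) by (metis rcos_self)
  then have w: "w \<in> K" unfolding w_def using subgroup.rcos_module[OF K(1) is_group] z by metis
  obtain h where h: "h \<in> H" "x \<otimes> w = h \<otimes> (w \<otimes> x)" using comm unfolding w_def by blast
  have mult: "\<rho> (a \<otimes> b) = \<rho> a \<otimes> \<rho> b" if "a \<in> K" "b \<in> K" for a b
    using \<rho>(1) that by (simp add: hom_def)
  have \<rho>w: "\<rho> w \<in> H" using \<rho>(1) w by (auto simp: hom_def)
  have K': "x \<in> K" "h \<in> K" using x h K by auto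
  \<comment> \<open>\<open>\<rho>\<close> fixes \<open>x\<close> and \<open>h\<close>. As
    \<open>\<rho> w\<close> lies in \<open>H\<close>, it commutes with \<open>x\<close>, which
    forces the commutator \<open>h\<close> to be trivial.\<close>
  have "x \<otimes> \<rho> w = h \<otimes> (\<rho> w \<otimes> x)"
    using arg_cong[OF h(2), of \<rho>] K' w \<rho>(2) x h(1) mult by (metis K.m_closed)
  then have "\<rho> w \<otimes> x = h \<otimes> (\<rho> w \<otimes> x)" using central \<rho>w by simp
  then have "h = \<one>" using \<rho>w x h by (metis H.mem_carrier m_closed r_cancel_one')
  then show False using h(2) nontriv[OF kl(1)] w x unfolding w_def by simp
qed

lemma (in group) subgroup_centralizer:
  assumes x: "x \<in> carrier G"
  shows "subgroup {h \<in> carrier G. x \<otimes> h = h \<otimes> x} G"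
proof (rule subgroupI)
  fix a assume a: "a \<in> {h \<in> carrier G. x \<otimes> h = h \<otimes> x}"
  then have ax: "a \<otimes> x = x \<otimes> a" by simp
  have "a \<otimes> (x \<otimes> inv a) = (x \<otimes> a) \<otimes> inv a"
    using a x by (simp add: m_assoc flip: ax)
  also have "\<dots> = x" using a x m_assoc[of x a "inv a"] by (simp del: mem_Collect_eq) auto
  finally have "x \<otimes> inv a = inv a \<otimes> x" using a x by (simp add: inv_solve_left)
  then show "inv a \<in> {h \<in> carrier G. x \<otimes> h = h \<otimes> x}" using a by simp
  fix b assume b: "b \<in> {h \<in> carrier G. x \<otimes> h = h \<otimes> x}"
  have "x \<otimes> (a \<otimes> b) = a \<otimes> (x \<otimes> b)" using a b x ax by (metis (no_types, lifting) m_assoc mem_Collect_eq)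
  also have "\<dots> = (a \<otimes> b) \<otimes> x" using a b x by (simp add: m_assoc)
  finally show "a \<otimes> b \<in> {h \<in> carrier G. x \<otimes> h = h \<otimes> x}" using a b by simp
qed (use x in auto)

section \<open>The lamplighter group\<close>

text \<open>The restricted wreath product of \<int>/2 with \<int>, each lamp configuration being
  encoded by its support. Pointwise addition becomes symmetric difference, and \<open>n\<close> acts
  by translation by \<open>- n\<close>.\<close>

definition lamplighter :: "(int set \<times> int) monoid" where
  "lamplighter =
     \<lparr>carrier = {A. finite A} \<times> UNIV,
      monoid.mult = (\<lambda>(A, n) (B, k). ({x. (x \<in> A) \<noteq> (x + n \<in> B)}, n + k)),
      one = ({}, 0)\<rparr>"

lemma finite_shift: "finite A \<Longrightarrow> finite {x. x + n \<in> A}" for A :: "int set"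
  by (rule finite_imageD[of "\<lambda>x. x + n"]) (auto intro: finite_subset[of _ A] simp: inj_on_def)

lemma finite_shift_minus: "finite A \<Longrightarrow> finite {x. x - n \<in> A}" for A :: "int set"
  using finite_shift[of A "- n"] by simp

lemma finite_sym_diff_shift: "finite A \<Longrightarrow> finite B \<Longrightarrow> finite {x. (x \<in> A) \<noteq> (x + n \<in> B)}"
  for A B :: "int set"
  by (rule finite_subset[of _ "A \<union> {x. x + n \<in> B}"]) (auto simp: finite_shift)

lemma lamplighter_carrier [simp]: "(A, n) \<in> carrier lamplighter \<longleftrightarrow> finite A"
  by (simp add: lamplighter_def)

lemma lamplighter_mult [simp]:
  "(A, n) \<otimes>\<^bsub>lamplighter\<^esub> (B, k) = ({x. (x \<in> A) \<noteq> (x + n \<in> B)}, n + k)"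
  by (simp add: lamplighter_def)

lemma lamplighter_one [simp]: "\<one>\<^bsub>lamplighter\<^esub> = ({}, 0)"
  by (simp add: lamplighter_def)

lemma group_lamplighter: "group lamplighter"
proof (rule groupI)
  fix x y z assume "x \<in> carrier lamplighter" "y \<in> carrier lamplighter" "z \<in> carrier lamplighter"
  then show "x \<otimes>\<^bsub>lamplighter\<^esub> y \<otimes>\<^bsub>lamplighter\<^esub> z =
      x \<otimes>\<^bsub>lamplighter\<^esub> (y \<otimes>\<^bsub>lamplighter\<^esub> z)"
    by (cases x; cases y; cases z) (auto simp: ac_simps)
next
  fix x assume x: "x \<in> carrier lamplighter"
  obtain A n where [simp]: "x = (A, n)" by force
  have "({x. x - n \<in> A}, - n) \<in> carrier lamplighter"
    using x by (simp add: finite_shift_minus)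
  moreover have "({x. x - n \<in> A}, - n) \<otimes>\<^bsub>lamplighter\<^esub> x = \<one>\<^bsub>lamplighter\<^esub>"
    by simp
  ultimately show "\<exists>y\<in>carrier lamplighter. y \<otimes>\<^bsub>lamplighter\<^esub> x = \<one>\<^bsub>lamplighter\<^esub>" by blast
next
  fix x y assume "x \<in> carrier lamplighter" "y \<in> carrier lamplighter"
  then show "x \<otimes>\<^bsub>lamplighter\<^esub> y \<in> carrier lamplighter"
    using finite_sym_diff_shift by (cases x; cases y) auto
qed auto

interpretation lamplighter: group lamplighter
  by (rule group_lamplighter)

lemma lamplighter_inv [simp]: "finite A \<Longrightarrow> inv\<^bsub>lamplighter\<^esub> (A, n) = ({x. x - n \<in> A}, - n)"
  by (rule lamplighter.inv_equality) (auto simp: finite_shift_minus)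

text \<open>Lamp configurations commute, so \<open>A\<close> cancels and only the translation
  acts.\<close>

lemma lamplighter_conj:
  assumes "finite A"
  shows "(A, n) \<otimes>\<^bsub>lamplighter\<^esub> (C, 0) \<otimes>\<^bsub>lamplighter\<^esub> inv\<^bsub>lamplighter\<^esub> (A, n) = ({x. x + n \<in> C}, 0)"
  using assms by auto

lemma lamplighter_sym_diff_closed:
  assumes "subgroup H lamplighter" "(A, 0) \<in> H" "(A', 0) \<in> H"
  shows "(sym_diff A A', 0) \<in> H"
proof -
  have "({x. (x \<in> A) \<noteq> (x \<in> A')}, 0) \<in> H"
    using subgroup.m_closed[OF assms] by simp
  moreover have "sym_diff A A' = {x. (x \<in> A) \<noteq> (x \<in> A')}" by auto
  ultimately show ?thesis by simp
qed

lemma lamplighter_translation_multiple: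
  assumes H: "subgroup H lamplighter" and g: "(g, m) \<in> H"
  shows "\<exists>a. (a, m * j) \<in> H"
proof -
  interpret H: subgroup H lamplighter by fact
  show ?thesis
  proof (induction j rule: int_induct[where k = 0])
    case base
    then show ?case using H.one_closed by auto
  next
    case (step1 i)
    then obtain a where "(a, m * i) \<in> H" by blast
    from H.m_closed[OF this g] show ?case by (auto simp: algebra_simps)
  next
    case (step2 i)
    then obtain a where "(a, m * i) \<in> H" by blast
    moreover have "finite g" using g H.subset by auto
    moreover have "inv\<^bsub>lamplighter\<^esub> (g, m) \<in> H" using g by (rule H.m_inv_closed)
    ultimately show ?case
      using H.m_closed[of "(a, m * i)" "inv\<^bsub>lamplighter\<^esub> (g, m)"] by (auto simp: algebra_simps)
  qed
qed

text \<open>The half-open window holds exactly one representative of each residue class modulo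
  \<open>2 * w\<close>.\<close>

lemma obtain_window:
  fixes W :: "int set"
  assumes W: "finite W"
  obtains w where "w > 0" "W \<subseteq> {-w..<w}"
proof -
  \<comment> \<open>Inserting 0 covers empty \<open>W\<close>; adding 1 makes \<open>w\<close>
    positive and accounts for the excluded right end.\<close>
  let ?w = "Max (insert 0 (abs ` W)) + 1"
  have le: "\<bar>x\<bar> \<le> Max (insert 0 (abs ` W))" if "x \<in> insert 0 W" for x
    using W that by (intro Max_ge) auto
  have "?w > 0" using le[of 0] by simp
  moreover have "W \<subseteq> {-?w..<?w}"
  proof
    fix x assume "x \<in> W"
    then show "x \<in> {-?w..<?w}" using le[of x] by auto
  qed
  ultimately show ?thesis using that by blast
qed

section \<open>Finite sets of integers as vectors over the field with two elements\<close>

lemma sym_diff_exchange: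
  "sym_diff (sym_diff A B) (sym_diff C D) = sym_diff (sym_diff A C) (sym_diff B D)"
  by blast

text \<open>A finite set is the sum of its singletons, and \<open>D\<close> is closed under
  sums.\<close>

lemma sym_diff_closed_finite:
  assumes "finite A" and empty: "{} \<in> D"
    and closed: "\<And>A B. \<lbrakk>A \<in> D; B \<in> D\<rbrakk> \<Longrightarrow> sym_diff A B \<in> D"
    and single: "\<And>x. x \<in> A \<Longrightarrow> {x} \<in> D"
  shows "A \<in> D"
  using assms(1) single
proof (induction A rule: finite_induct)
  case (insert x F)
  then have "sym_diff {x} F \<in> D" using closed by blast
  moreover have "sym_diff {x} F = insert x F" using insert by auto
  ultimately show ?case by simp
qed (rule empty)

text \<open>A coordinate subspace that is maximal among those meeting \<open>L\<close> trivially: adding any further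
  coordinate creates a nonzero intersection, which must involve that coordinate.\<close>

lemma obtain_complementary_coordinates:
  assumes "finite I"
  obtains B where "B \<subseteq> I" "\<And>A. \<lbrakk>A \<in> L; r ` A \<subseteq> B\<rbrakk> \<Longrightarrow> A = {}"
    "\<And>i. i \<in> I - B \<Longrightarrow> \<exists>A\<in>L. r ` A \<subseteq> insert i B \<and> i \<in> r ` A"
proof -
  define \<B> where "\<B> = {B. B \<subseteq> I \<and> (\<forall>A\<in>L. r ` A \<subseteq> B \<longrightarrow> A = {})}"
  have "finite \<B>" using assms by (auto simp: \<B>_def)
  moreover have "{} \<in> \<B>" by (auto simp: \<B>_def)
  ultimately obtain B where B: "B \<in> \<B>" "\<forall>B'\<in>\<B>. B \<subseteq> B' \<longrightarrow> B = B'"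
    using finite_has_maximal by blast
  have "\<exists>A\<in>L. r ` A \<subseteq> insert i B \<and> i \<in> r ` A" if i: "i \<in> I - B" for i
  proof -
    have "insert i B \<notin> \<B>" using B(2) i by blast
    then obtain A where A: "A \<in> L" "r ` A \<subseteq> insert i B" "A \<noteq> {}"
      using B(1) i by (auto simp: \<B>_def)
    moreover have "\<not> r ` A \<subseteq> B" using A B(1) by (auto simp only: \<B>_def mem_Collect_eq)
    ultimately have "i \<in> r ` A" by blast
    then show ?thesis using A by blast
  qed
  then show ?thesis using B(1) that[of B] by (auto simp: \<B>_def)
qed

section \<open>Folding configurations modulo \<open>2 * w\<close>\<close>

lemma even_card_sym_diff:
  assumes "finite A" "finite B"
  shows "even (card (sym_diff A B)) \<longleftrightarrow> (even (card A) \<longleftrightarrow> even (card B))"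
proof -
  have "card (sym_diff A B) = card (A - B) + card (B - A)"
    using assms by (intro card_Un_disjoint) auto
  moreover have "card A = card (A \<inter> B) + card (A - B)" "card B = card (A \<inter> B) + card (B - A)"
    using card_Int_Diff[of A B] card_Int_Diff[of B A] assms by (simp_all add: Int_commute)
  ultimately show ?thesis by simp presburger
qed

text \<open>The linear map induced by reducing positions modulo \<open>2 * w\<close>: parity of the
  cardinality is the sum of the coefficients in a residue class, and the window supplies the class
  representatives.\<close>

definition fold_window :: "int \<Rightarrow> int set \<Rightarrow> int set" where
  "fold_window w A = {i \<in> {-w..<w}. odd (card {x \<in> A. x mod (2 * w) = i mod (2 * w)})}"

lemma fold_window_id:
  assumes "A \<subseteq> {-w..<w}"
  shows "fold_window w A = A"
proof -
  have inj: "x = i" if "x \<in> {-w..<w}" "i \<in> {-w..<w}" "x mod (2 * w) = i mod (2 * w)" for x i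
  proof -
    \<comment> \<open>Adding \<open>w\<close> moves the window to \<open>{0..<2 * w}\<close>, where
      reduction modulo \<open>2 * w\<close> is the identity.\<close>
    have "(x + w) mod (2 * w) = (i + w) mod (2 * w)" using that(3) by (metis mod_add_left_eq)
    then show ?thesis using that(1,2) by simp
  qed
  have "{x \<in> A. x mod (2 * w) = i mod (2 * w)} = (if i \<in> A then {i} else {})"
    if i: "i \<in> {-w..<w}" for i
  proof -
    have "x = i" if "x \<in> A" "x mod (2 * w) = i mod (2 * w)" for x
      using inj[OF _ i that(2)] that(1) assms by blast
    then show ?thesis by auto
  qed
  then have "fold_window w A = {i \<in> {-w..<w}. odd (card (if i \<in> A then {i} else {}))}"
    unfolding fold_window_def by (intro Collect_cong conj_cong) simp_all
  also have "\<dots> = A" using assms by (auto split: if_splits)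
  finally show ?thesis .
qed

lemma fold_window_sym_diff:
  assumes "finite A" "finite B"
  shows "fold_window w (sym_diff A B) = sym_diff (fold_window w A) (fold_window w B)"
proof -
  have "{x \<in> sym_diff A B. P x} = sym_diff {x \<in> A. P x} {x \<in> B. P x}" for P by auto
  then show ?thesis using assms by (auto simp: fold_window_def even_card_sym_diff)
qed

text \<open>Translation by a multiple of \<open>2 * w\<close> permutes each residue class.\<close>

lemma fold_window_shift:
  assumes "2 * w dvd n"
  shows "fold_window w {x. x + n \<in> A} = fold_window w A"
proof -
  have mod: "(x + n) mod (2 * w) = x mod (2 * w)" for x
    using assms by (auto simp: dvd_def)
  have "card {x \<in> {x. x + n \<in> A}. x mod (2 * w) = i} = card {x \<in> A. x mod (2 * w) = i}" for i
  proof (rule bij_betw_same_card[of "\<lambda>x. x + n"])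
    show "bij_betw (\<lambda>x. x + n) {x \<in> {x. x + n \<in> A}. x mod (2 * w) = i} {x \<in> A. x mod (2 * w) = i}"
      by (rule bij_betw_byWitness[of _ "\<lambda>x. x - n"]) (use mod[of "_ - n"] mod in auto)
  qed
  then show ?thesis by (simp add: fold_window_def)
qed

text \<open>All of \<open>H\<close> lives in a window, on which folding is the identity. A
  complement of \<open>H\<close> among the window configurations is pulled back along folding, which
  ignores translations by multiples of \<open>2 * w\<close>.\<close>

lemma lamplighter_virtual_retract_finite:
  assumes H: "subgroup H lamplighter" and W: "finite W"
    and HW: "\<And>A n. (A, n) \<in> H \<Longrightarrow> A \<subseteq> W \<and> n = 0"
  shows "virtual_retract H lamplighter"
proof -
  interpret H: subgroup H lamplighter by fact
  obtain w where w: "w > 0" "W \<subseteq> {-w..<w}" by (rule obtain_window[OF W])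
  let ?F = "fold_window w"
  define L where "L = {A. (A, 0) \<in> H}"
  have Lfin: "finite A" "A \<subseteq> {-w..<w}" "?F A = A" if "A \<in> L" for A
  proof -
    show "finite A" using that H.subset by (auto simp: L_def)
    show "A \<subseteq> {-w..<w}" using that HW w(2) by (fastforce simp: L_def)
    then show "?F A = A" by (rule fold_window_id)
  qed
  have Lsd: "sym_diff A A' \<in> L" if "A \<in> L" "A' \<in> L" for A A'
    using lamplighter_sym_diff_closed[OF H] that by (simp add: L_def)
  have Lempty: "{} \<in> L" using H.one_closed by (simp add: L_def)
  obtain B where B: "B \<subseteq> {-w..<w}" "\<And>A. \<lbrakk>A \<in> L; id ` A \<subseteq> B\<rbrakk> \<Longrightarrow> A = {}"
    "\<And>i. i \<in> {-w..<w} - B \<Longrightarrow> \<exists>A\<in>L. id ` A \<subseteq> insert i B \<and> i \<in> id ` A"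
    using obtain_complementary_coordinates[of "{-w..<w}" L id] by blast
  \<comment> \<open>\<open>D\<close> is the sum of \<open>L\<close> and the coordinate subspace of
    \<open>B\<close>. It turns out to contain every window configuration, so the two are
    complementary.\<close>
  define D where "D = {sym_diff A C | A C. A \<in> L \<and> C \<subseteq> B}"
  have DI: "U \<in> D" if "A \<in> L" "C \<subseteq> B" "U = sym_diff A C" for U A C
    using that by (auto simp: D_def)
  have D: "A \<in> D" if A: "A \<subseteq> {-w..<w}" for A
  proof (rule sym_diff_closed_finite)
    show "finite A" using A finite_subset by blast
    show "{} \<in> D" using Lempty by (force simp: D_def)
    fix U V assume "U \<in> D" "V \<in> D"
    then obtain A C A' C' where *: "U = sym_diff A C" "A \<in> L" "C \<subseteq> B" "V = sym_diff A' C'" "A' \<in> L" "C' \<subseteq> B"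
      unfolding D_def by blast
    have "sym_diff U V = sym_diff (sym_diff A A') (sym_diff C C')"
      unfolding * by (rule sym_diff_exchange)
    moreover have "sym_diff C C' \<subseteq> B" using * by auto
    ultimately show "sym_diff U V \<in> D" using DI[OF Lsd[OF *(2,5)]] by blast
  next
    fix x assume x: "x \<in> A"
    show "{x} \<in> D"
    proof (cases "x \<in> B")
      case True
      then show ?thesis by (intro DI[OF Lempty, of "{x}"]) auto
    next
      case False
      then obtain A where "A \<in> L" "A \<subseteq> insert x B" "x \<in> A" using B(3)[of x] subsetD[OF A x] by auto
      \<comment> \<open>Cancelling the part of \<open>A\<close> inside \<open>B\<close> leaves just
        \<open>{x}\<close>.\<close>
      then show ?thesis by (intro DI[of A "A - {x}"]) auto
    qed
  qed
  \<comment> \<open>On pairs whose translation is divisible by \<open>2 * w\<close>, folding the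
    lamp part is a homomorphism to an abelian group. \<open>N\<close> is the preimage of the
    coordinate subspace of \<open>B\<close>.\<close>
  define N where "N = {(A, n). finite A \<and> 2 * w dvd n \<and> ?F A \<subseteq> B}"
  have mult: "?F {x. (x \<in> A) \<noteq> (x + n \<in> A')} = sym_diff (?F A) (?F A')"
    if "finite A" "finite A'" "2 * w dvd n" for A A' n
  proof -
    have "{x. (x \<in> A) \<noteq> (x + n \<in> A')} = sym_diff A {x. x + n \<in> A'}" by auto
    then show ?thesis using that by (simp add: fold_window_sym_diff finite_shift fold_window_shift)
  qed
  show ?thesis
  proof (rule lamplighter.virtual_retractI_complement[OF H])
    show "subgroup N lamplighter"
    proof (rule lamplighter.subgroupI)
      show "N \<subseteq> carrier lamplighter" by (auto simp: N_def)
      have "({}, 0) \<in> N" by (auto simp: N_def fold_window_def)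
      then show "N \<noteq> {}" by auto
      fix a assume a: "a \<in> N"
      obtain A n where [simp]: "a = (A, n)" by force
      show "inv\<^bsub>lamplighter\<^esub> a \<in> N"
        using a fold_window_shift[of w "- n" A] by (auto simp: N_def finite_shift_minus)
      fix b assume b: "b \<in> N"
      obtain A' n' where [simp]: "b = (A', n')" by force
      show "a \<otimes>\<^bsub>lamplighter\<^esub> b \<in> N"
        using a b mult[of A A' n] finite_sym_diff_shift[of A A' n] by (auto simp: N_def)
    qed
    show "h \<otimes>\<^bsub>lamplighter\<^esub> n \<otimes>\<^bsub>lamplighter\<^esub> inv\<^bsub>lamplighter\<^esub> h \<in> N" if h: "h \<in> H" and n: "n \<in> N" for h n
    proof -
      obtain A where A: "h = (A, 0)" using HW h by (cases h) auto
      then have "A \<in> L" using h by (simp add: L_def)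
      obtain C k where C: "n = (C, k)" by force
      let ?S = "{x. (x \<in> A) \<noteq> (x + 0 \<in> C)}"
      have fin: "finite A" "finite C" "finite ?S"
        using Lfin \<open>A \<in> L\<close> n C finite_sym_diff_shift[of A C 0] by (auto simp: N_def)
      have k: "2 * w dvd k" using n C by (simp add: N_def)
      \<comment> \<open>Conjugation by \<open>h\<close> contributes \<open>?F A\<close> twice, and
        these cancel.\<close>
      have "?F {x. (x \<in> ?S) \<noteq> (x + k \<in> A)} = ?F C"
        using mult[OF fin(3,1) k] mult[OF fin(1,2), of 0] by auto
      moreover have "finite {x. (x \<in> ?S) \<noteq> (x + k \<in> A)}" using finite_sym_diff_shift fin by blast
      moreover have "h \<otimes>\<^bsub>lamplighter\<^esub> n \<otimes>\<^bsub>lamplighter\<^esub> inv\<^bsub>lamplighter\<^esub> h = ({x. (x \<in> ?S) \<noteq> (x + k \<in> A)}, k)"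
        using fin by (simp add: A C)
      ultimately show ?thesis using n by (auto simp: N_def C)
    qed
    show "H \<inter> N \<subseteq> {\<one>\<^bsub>lamplighter\<^esub>}"
    proof
      fix a assume a: "a \<in> H \<inter> N"
      then obtain A where A: "a = (A, 0)" using HW by (cases a) auto
      then have "A \<in> L" using a by (simp add: L_def)
      moreover have "A \<subseteq> B" using a A Lfin(3)[OF \<open>A \<in> L\<close>] by (simp add: N_def)
      ultimately show "a \<in> {\<one>\<^bsub>lamplighter\<^esub>}" using B(2) A by simp
    qed
    show "finite ({{}} \<times> {0..<2 * w})" by simp
    show "{{}} \<times> {0..<2 * w} \<subseteq> carrier lamplighter" by auto
    fix x assume x: "x \<in> carrier lamplighter"
    obtain f n where f: "x = (f, n)" "finite f" using x by (cases x) auto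
    have "?F f \<in> D" by (rule D) (auto simp: fold_window_def)
    then obtain A C where AC: "?F f = sym_diff A C" "A \<in> L" "C \<subseteq> B" by (auto simp: D_def)
    \<comment> \<open>Adding \<open>A\<close> to \<open>f\<close> removes the \<open>L\<close>-part
      of \<open>?F f\<close>, because folding fixes \<open>A\<close>.\<close>
    have "?F (sym_diff A f) = C"
      using AC f Lfin by (auto simp: fold_window_sym_diff)
    then have "(sym_diff A f, 2 * w * (n div (2 * w))) \<in> N"
      using f Lfin AC by (auto simp: N_def)
    moreover have "(A, 0) \<in> H" using AC by (simp add: L_def)
    moreover have "({}, n mod (2 * w)) \<in> {{}} \<times> {0..<2 * w}" using w by simp
    moreover have "x = (A, 0) \<otimes>\<^bsub>lamplighter\<^esub> (sym_diff A f, 2 * w * (n div (2 * w)))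
        \<otimes>\<^bsub>lamplighter\<^esub> ({}, n mod (2 * w))"
      by (auto simp: f)
    ultimately show "\<exists>h\<in>H. \<exists>k\<in>N. \<exists>t\<in>{{}} \<times> {0..<2 * w}.
        x = h \<otimes>\<^bsub>lamplighter\<^esub> k \<otimes>\<^bsub>lamplighter\<^esub> t"
      by blast
  qed
qed

text \<open>In the following lemma the subgroup acts on the finite sets of integers through translation
  by \<open>m\<close>, so these form a free module over the Laurent polynomials in \<open>m\<close>-translation with the
  residue classes modulo \<open>m\<close> as basis. Singletons are moved into the window \<open>{-w..w}\<close> by polynomial
  division: the leading coefficients are automatically units.\<close>

lemma lamplighter_virtual_retract_infinite:
  assumes H: "subgroup H lamplighter" and m: "m > 0" "(g, m) \<in> H"
    and Hm: "\<And>A n. (A, n) \<in> H \<Longrightarrow> m dvd n"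
  shows "virtual_retract H lamplighter"
proof -
  interpret H: subgroup H lamplighter by fact
  have powers: "\<exists>a. (a, m * j) \<in> H" for j
    using lamplighter_translation_multiple[OF H m(2)] .
  define L where "L = {A. (A, 0) \<in> H}"
  have Lfin: "finite A" if "A \<in> L" for A
    using that H.subset by (auto simp: L_def)
  have Lsd: "sym_diff A A' \<in> L" if "A \<in> L" "A' \<in> L" for A A'
    using lamplighter_sym_diff_closed[OF H] that by (simp add: L_def)
  have Lempty: "{} \<in> L" using H.one_closed by (simp add: L_def)
  \<comment> \<open>\<open>H\<close> contains an element with translation \<open>n\<close>;
    conjugating by it realises the shift inside \<open>H\<close>.\<close>
  have Lshift: "{x. x + n \<in> A} \<in> L" if A: "A \<in> L" and n: "m dvd n" for A n
  proof -
    obtain a where a: "(a, n) \<in> H" using powers n by (auto simp: dvd_def)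
    then have "finite a" using H.subset by auto
    then show ?thesis
      using lamplighter_conj[of a n A] a A H.m_closed[OF H.m_closed[OF a] H.m_inv_closed[OF a]]
      by (metis L_def mem_Collect_eq)
  qed
  define r where "r x = x mod m" for x
  have r_shift: "r (x + n) = r x" if "m dvd n" for x n using that by (auto simp: r_def dvd_def)
  obtain B where B: "B \<subseteq> {0..<m}" "\<And>A. \<lbrakk>A \<in> L; r ` A \<subseteq> B\<rbrakk> \<Longrightarrow> A = {}"
    "\<And>i. i \<in> {0..<m} - B \<Longrightarrow> \<exists>A\<in>L. r ` A \<subseteq> insert i B \<and> i \<in> r ` A"
    using obtain_complementary_coordinates[of "{0..<m}" L r] by blast
  then obtain l where l: "\<And>i. i \<in> {0..<m} - B \<Longrightarrow> l i \<in> L \<and> r ` l i \<subseteq> insert i B \<and> i \<in> r ` l i"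
    by metis
  have "finite (\<Union>i\<in>{0..<m} - B. l i)" using l Lfin by blast
  then obtain w where "(\<Union>i\<in>{0..<m} - B. l i) \<subseteq> {-w..<w}" by (rule obtain_window)
  then have w: "(\<Union>i\<in>{0..<m} - B. l i) \<subseteq> {-w..w}" by force
  \<comment> \<open>The submodule spanned by the residue classes in \<open>B\<close>; by the choice
    of \<open>B\<close> it meets \<open>L\<close> only in \<open>{}\<close>.\<close>
  define C where "C = {c. finite c \<and> r ` c \<subseteq> B}"
  have Csd: "sym_diff c c' \<in> C" if "c \<in> C" "c' \<in> C" for c c' using that by (auto simp: C_def)
  have Cshift: "{x. x + n \<in> c} \<in> C" if "c \<in> C" "m dvd n" for c n
    using that r_shift[of n] by (force simp: C_def finite_shift)
  \<comment> \<open>Showing that \<open>D\<close> contains all finite sets means that, modulo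
    \<open>L\<close> and \<open>C\<close>, only the finitely many configurations in the window
    remain.\<close>
  define D where "D = {sym_diff (sym_diff A c) v | A c v. A \<in> L \<and> c \<in> C \<and> v \<subseteq> {-w..w}}"
  have DI: "U \<in> D" if "A \<in> L" "c \<in> C" "v \<subseteq> {-w..w}" "U = sym_diff (sym_diff A c) v" for U A c v
    using that by (auto simp: D_def)
  have Cempty: "{} \<in> C" by (simp add: C_def)
  have Dempty: "{} \<in> D" by (rule DI[OF Lempty Cempty, of "{}"]) auto
  have Dsd: "sym_diff U V \<in> D" if UV: "U \<in> D" "V \<in> D" for U V
  proof -
    obtain A c v A' c' v' where *: "U = sym_diff (sym_diff A c) v" "A \<in> L" "c \<in> C" "v \<subseteq> {-w..w}"
      "V = sym_diff (sym_diff A' c') v'" "A' \<in> L" "c' \<in> C" "v' \<subseteq> {-w..w}"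
      using UV unfolding D_def by blast
    show ?thesis
    proof (rule DI[OF Lsd[OF *(2,6)] Csd[OF *(3,7)]])
      show "sym_diff v v' \<subseteq> {-w..w}" using * by blast
      show "sym_diff U V = sym_diff (sym_diff (sym_diff A A') (sym_diff c c')) (sym_diff v v')"
        unfolding * sym_diff_exchange[of _ v] sym_diff_exchange[of A c] ..
    qed
  qed
  have Dsingle: "{x} \<in> D" for x
  proof (induction x rule: measure_induct_rule[of "\<lambda>x. nat \<bar>x\<bar>"])
    case (less x)
    show ?case
    proof (cases "r x \<in> B")
      case True
      then have "{x} \<in> C" by (simp add: C_def)
      then show ?thesis by (rule DI[OF Lempty _, of _ "{}"]) auto
    next
      case False
      show ?thesis
      proof (cases "x \<in> {-w..w}")
        case True
        then show ?thesis by (intro DI[OF Lempty Cempty, of "{x}"]) auto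
      next
        case xw: False
        have i: "r x \<in> {0..<m} - B" using False m(1) by (simp add: r_def)
        let ?q = "{y \<in> l (r x). r y = r x}"
        have li: "l (r x) \<in> L" "r ` l (r x) \<subseteq> insert (r x) B" "r x \<in> r ` l (r x)"
          using l[OF i] by blast+
        have q: "finite ?q" using Lfin[OF li(1)] by simp
        have q_ne: "?q \<noteq> {}" using li(3) by force
        have q_window: "?q \<subseteq> {-w..w}" using w i by fast
        \<comment> \<open>The leading position of the part of \<open>l (r x)\<close> in the class of
          \<open>x\<close>, on the side where \<open>x\<close> lies. Shifting \<open>p\<close> to
          \<open>x\<close> puts all other positions on the side of \<open>x\<close> towards
          0.\<close>
        define p where "p = (if x > 0 then Max ?q else Min ?q)"
        have p: "p \<in> ?q" using Max_in[OF q q_ne] Min_in[OF q q_ne] unfolding p_def by presburger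
        have dv: "m dvd p - x" using p by (simp add: r_def mod_eq_dvd_iff)
        let ?s = "\<lambda>A. {y. y + (p - x) \<in> A}"
        have "?s (l (r x)) \<in> L" using Lshift li(1) dv by blast
        moreover have "?s (l (r x) - ?q) \<in> C"
        proof (rule Cshift[OF _ dv])
          show "l (r x) - ?q \<in> C" using li(2) Lfin[OF li(1)] by (auto simp: C_def)
        qed
        \<comment> \<open>The shift of \<open>l (r x)\<close> is in \<open>L\<close>, and its part
          outside the class of \<open>x\<close> is in \<open>C\<close>.\<close>
        ultimately have sq: "?s ?q \<in> D" by (rule DI[of _ _ "{}"]) auto
        have "?s ?q - {x} \<in> D"
        proof (rule sym_diff_closed_finite[OF _ Dempty Dsd])
          show "finite (?s ?q - {x})" using finite_shift[OF q] by simp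
          fix y assume y: "y \<in> ?s ?q - {x}"
          then have yq: "y + (p - x) \<in> ?q" "y \<noteq> x" by auto
          have "y + (p - x) \<in> {-w..w}" "p \<in> {-w..w}" using yq q_window p by blast+
          moreover have "if x > 0 then y + (p - x) \<le> p else y + (p - x) \<ge> p"
            using Max_ge[OF q yq(1)] Min_le[OF q yq(1)] by (cases "x > 0") (simp_all add: p_def)
          \<comment> \<open>Both \<open>p\<close> and the unshifted \<open>y\<close> lie in the
            window, so \<open>y\<close> is at most \<open>2 * w\<close> away from \<open>x\<close>,
            in the direction of 0. As \<open>x\<close> is outside the window, \<open>y\<close>
            cannot reach \<open>- x\<close>.\<close>
          ultimately have "\<bar>y\<bar> < \<bar>x\<bar>" using xw yq(2) by (auto split: if_splits)
          then show "{y} \<in> D" by (intro less) auto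
        qed
        then have "sym_diff (?s ?q) (?s ?q - {x}) \<in> D" using sq Dsd by blast
        moreover have "sym_diff (?s ?q) (?s ?q - {x}) = {x}" using p by auto
        ultimately show ?thesis by simp
      qed
    qed
  qed
  have D: "A \<in> D" if "finite A" for A
    using sym_diff_closed_finite[OF that Dempty Dsd Dsingle] by blast
  let ?T = "Pow {-w..w} \<times> {0..<m}"
  show ?thesis
  proof (rule lamplighter.virtual_retractI_complement[OF H])
    show "subgroup (C \<times> {0}) lamplighter"
    proof (rule lamplighter.subgroupI)
      show "C \<times> {0} \<subseteq> carrier lamplighter" by (auto simp: C_def)
      show "C \<times> {0} \<noteq> {}" using Cempty by auto
      fix a :: "int set \<times> int" assume a: "a \<in> C \<times> {0}"
      show "inv\<^bsub>lamplighter\<^esub> a \<in> C \<times> {0}" using a by (auto simp: C_def)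
      fix b :: "int set \<times> int" assume b: "b \<in> C \<times> {0}"
      show "a \<otimes>\<^bsub>lamplighter\<^esub> b \<in> C \<times> {0}"
      proof -
        obtain c c' where c: "a = (c, 0)" "b = (c', 0)" "c \<in> C" "c' \<in> C" using a b by auto
        have "{x. (x \<in> c) \<noteq> (x \<in> c')} = sym_diff c c'" by auto
        then show ?thesis using Csd[OF c(3,4)] c by simp
      qed
    qed
    show "h \<otimes>\<^bsub>lamplighter\<^esub> n \<otimes>\<^bsub>lamplighter\<^esub> inv\<^bsub>lamplighter\<^esub> h \<in> C \<times> {0}"
      if h: "h \<in> H" and n: "n \<in> C \<times> {0}" for h n
    proof -
      obtain A k c where *: "h = (A, k)" "n = (c, 0)" "c \<in> C" using n by (cases h) auto
      then have "finite A" "m dvd k" using h H.subset Hm by auto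
      then show ?thesis using Cshift * lamplighter_conj by simp
    qed
    show "H \<inter> (C \<times> {0}) \<subseteq> {\<one>\<^bsub>lamplighter\<^esub>}"
      using B(2) by (auto simp: C_def L_def)
    show "finite ?T" by simp
    show "?T \<subseteq> carrier lamplighter" using finite_subset[of _ "{-w..w}"] by auto
    fix x assume x: "x \<in> carrier lamplighter"
    obtain f n where f: "x = (f, n)" "finite f" using x by (cases x) auto
    let ?k = "m * (n div m)"
    obtain a where a: "(a, ?k) \<in> H" using powers by blast
    then have fa: "finite a" using H.subset by auto
    \<comment> \<open>The lamp part left after splitting off \<open>(a, ?k)\<close> on the left:
      cancel \<open>a\<close>, then undo its translation.\<close>
    let ?f = "{x. x - ?k \<in> sym_diff a f}"
    have "?f \<in> D" using fa f by (intro D finite_shift_minus) auto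
    then obtain A c v where *: "?f = sym_diff (sym_diff A c) v" "A \<in> L" "c \<in> C" "v \<subseteq> {-w..w}"
      by (auto simp: D_def)
    have "(a, ?k) \<otimes>\<^bsub>lamplighter\<^esub> (A, 0) \<in> H" using a *(2) by (intro H.m_closed) (auto simp: L_def)
    moreover have "(c, 0) \<in> C \<times> {0}" using * by simp
    moreover have "(v, n mod m) \<in> ?T" using * m(1) by simp
    moreover have "x = (a, ?k) \<otimes>\<^bsub>lamplighter\<^esub> (A, 0) \<otimes>\<^bsub>lamplighter\<^esub> (c, 0) \<otimes>\<^bsub>lamplighter\<^esub> (v, n mod m)"
    proof -
      have "(y \<in> f) = ((y \<in> a) \<noteq> (((y + ?k \<in> A) \<noteq> (y + ?k \<in> c)) \<noteq> (y + ?k \<in> v)))" for y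
      proof -
        have "(y + ?k \<in> ?f) = (((y + ?k \<in> A) \<noteq> (y + ?k \<in> c)) \<noteq> (y + ?k \<in> v))" unfolding *(1) by auto
        moreover have "(y + ?k \<in> ?f) = ((y \<in> a) \<noteq> (y \<in> f))" by auto
        ultimately show ?thesis by blast
      qed
      then have "f = {y. (((y \<in> a) \<noteq> (y + ?k \<in> A)) \<noteq> (y + ?k \<in> c)) \<noteq> (y + ?k \<in> v)}" by blast
      then show ?thesis by (simp add: f)
    qed
    ultimately show "\<exists>h\<in>H. \<exists>k\<in>C \<times> {0}. \<exists>t\<in>?T. x = h \<otimes>\<^bsub>lamplighter\<^esub> k \<otimes>\<^bsub>lamplighter\<^esub> t"
      by blast
  qed
qed

text \<open>The translation parts of \<open>H\<close> form a subgroup of \<int>. If it is nonzero,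
  its least positive element generates it; if it is zero, the supports of the finitely many
  generators bound all of \<open>H\<close>.\<close>

lemma property_LR_lamplighter: "property_LR lamplighter"
  unfolding property_LR_def
proof (intro allI impI)
  fix H assume "finitely_generated_subgroup H lamplighter"
  then obtain S where S: "finite S" "S \<subseteq> carrier lamplighter" "H = generate lamplighter S"
    by (auto simp: finitely_generated_subgroup_def)
  have H: "subgroup H lamplighter" using S lamplighter.generate_is_subgroup by simp
  interpret H: subgroup H lamplighter by fact
  have fin: "finite A" if "(A, n) \<in> H" for A n using that H.subset by auto
  show "virtual_retract H lamplighter"
  proof (cases "\<exists>A n. (A, n) \<in> H \<and> n \<noteq> 0")
    case True
    then obtain A n where An: "(A, n) \<in> H" "n \<noteq> 0" by blast
    have inv: "(\<exists>A. (A, - k) \<in> H)" if "(A, k) \<in> H" for A k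
      using H.m_inv_closed[OF that] fin[OF that] by auto
    define P where "P k \<longleftrightarrow> k > 0 \<and> (\<exists>A. (A, int k) \<in> H)" for k :: nat
    have "\<exists>k. P k"
    proof (cases "n > 0")
      case True
      then show ?thesis using An by (intro exI[of _ "nat n"]) (auto simp: P_def)
    next
      case False
      then show ?thesis using An inv by (intro exI[of _ "nat (- n)"]) (auto simp: P_def)
    qed
    then obtain k where k: "P k" "\<And>j. P j \<Longrightarrow> k \<le> j" by (metis LeastI Least_le)
    then obtain g where g: "(g, int k) \<in> H" "k > 0" by (auto simp: P_def)
    show ?thesis
    proof (rule lamplighter_virtual_retract_infinite[OF H _ g(1)])
      show "int k > 0" using g(2) by simp
      fix A n assume An: "(A, n) \<in> H"
      \<comment> \<open>Division with remainder: the remainder is again a translation part of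
        \<open>H\<close>, so minimality of \<open>k\<close> makes it 0.\<close>
      obtain B where "(B, int k * (- (n div int k))) \<in> H"
        using lamplighter_translation_multiple[OF H g(1)] by blast
      from H.m_closed[OF An this] have "\<exists>A. (A, n mod int k) \<in> H"
        by (auto simp: minus_mult_div_eq_mod)
      moreover have "\<not> P (nat (n mod int k))"
      proof
        assume "P (nat (n mod int k))"
        then have "k \<le> nat (n mod int k)" by (rule k(2))
        moreover have "n mod int k < int k" using g(2) by (intro pos_mod_bound) simp
        ultimately show False using g(2) by linarith
      qed
      ultimately have "\<not> n mod int k > 0" by (auto simp: P_def)
      moreover have "n mod int k \<ge> 0" using g(2) by (intro pos_mod_sign) simp
      ultimately show "int k dvd n" by (simp add: dvd_eq_mod_eq_0)
    qed
  next
    case False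
    then have zero: "n = 0" if "(A, n) \<in> H" for A n using that by blast
    let ?W = "\<Union>(fst ` S)"
    have sub: "fst h \<subseteq> ?W" if "h \<in> generate lamplighter S" for h
      using that
    proof (induction rule: generate.induct)
      case (inv h)
      then obtain A n where "h = (A, n)" "(A, n) \<in> H" using S(3) by (cases h) (auto intro: generate.incl)
      then show ?case using fin zero inv by force
    next
      case (eng h h')
      then obtain A A' where A: "h = (A, 0)" "h' = (A', 0)" using zero S(3) by (metis surj_pair)
      then show ?case using eng by auto
    qed auto
    show ?thesis
    proof (rule lamplighter_virtual_retract_finite[OF H])
      show "finite ?W" using S(1,2) by auto
      show "A \<subseteq> ?W \<and> n = 0" if "(A, n) \<in> H" for A n
        using sub[of "(A, n)"] zero[OF that] that S(3) by simp
    qed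
  qed
qed

section \<open>The wreath product and its extension by the coordinate swap\<close>

abbreviation klein :: "(int \<times> int) monoid" where
  "klein \<equiv> integer_mod_group 2 \<times>\<times> integer_mod_group 2"

abbreviation klein_wreath :: "((int \<Rightarrow> int \<times> int) \<times> int) monoid" where
  "klein_wreath \<equiv> restricted_wreath klein integer_group"

lemma carrier_mod2 [simp]: "carrier (integer_mod_group 2) = {0, 1}"
  by (auto simp: carrier_integer_mod_group)

lemma group_klein: "group klein"
  by (simp add: DirProd_group)

lemma group_klein_wreath: "group klein_wreath"
  by (intro group_restricted_wreath group_klein group_integer_group)

lemma klein_wreath_carrier [simp]:
  "(f, n) \<in> carrier klein_wreath \<longleftrightarrow>
     (\<forall>x. fst (f x) \<in> {0, 1} \<and> snd (f x) \<in> {0, 1}) \<and> finite {x. f x \<noteq> (0, 0)}"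
proof -
  have "(f, n) \<in> carrier klein_wreath \<longleftrightarrow> (\<forall>x. f x \<in> {0, 1} \<times> {0, 1}) \<and> finite {x. f x \<noteq> (0, 0)}"
    by (simp add: restricted_wreath_def semidirect_product_def carrier_wreath_base group_klein
        PiE_UNIV_domain Pi_iff)
  then show ?thesis by (simp only: mem_Times_iff)
qed

lemma klein_wreath_mult [simp]:
  "(f, n) \<otimes>\<^bsub>klein_wreath\<^esub> (g, k) =
     (\<lambda>x. ((fst (f x) + fst (g (x + n))) mod 2, (snd (f x) + snd (g (x + n))) mod 2), n + k)"
  by (simp add: restricted_wreath_def semidirect_product_def wreath_base_def wreath_action_def
      mult_integer_mod_group fun_eq_iff case_prod_beta DirProd_def)

lemma klein_wreath_one [simp]: "\<one>\<^bsub>klein_wreath\<^esub> = (\<lambda>x. (0, 0), 0)"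
  by (simp add: restricted_wreath_def semidirect_product_def wreath_base_def fun_eq_iff)

text \<open>Since \<open>div\<close> rounds down, each integer, negative ones included, is
  \<open>2 * y\<close> or \<open>2 * y + 1\<close> with \<open>y = x div 2\<close>. A unit
  translation moves past two positions, hence the factor 2.\<close>

definition interleave :: "(int \<Rightarrow> int \<times> int) \<times> int \<Rightarrow> int set \<times> int" where
  "interleave = (\<lambda>(f, n). ({x. (if even x then fst else snd) (f (x div 2)) = 1}, 2 * n))"

lemma interleave_hom: "interleave \<in> hom klein_wreath lamplighter"
proof (rule homI)
  fix a assume a: "a \<in> carrier klein_wreath"
  obtain f n where [simp]: "a = (f, n)" by force
  let ?S = "{x. f x \<noteq> (0, 0)}"
  have "{x. (if even x then fst else snd) (f (x div 2)) = 1} \<subseteq> (\<lambda>y. 2 * y) ` ?S \<union> (\<lambda>y. 2 * y + 1) ` ?S"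
  proof
    fix x assume "x \<in> {x. (if even x then fst else snd) (f (x div 2)) = 1}"
    then have "x div 2 \<in> ?S" by (auto split: if_splits)
    moreover have "x = 2 * (x div 2) \<or> x = 2 * (x div 2) + 1" by presburger
    ultimately show "x \<in> (\<lambda>y. 2 * y) ` ?S \<union> (\<lambda>y. 2 * y + 1) ` ?S" by blast
  qed
  moreover have "finite ?S" using a by simp
  ultimately have "finite {x. (if even x then fst else snd) (f (x div 2)) = 1}"
    using finite_subset by blast
  then show "interleave a \<in> carrier lamplighter" by (simp add: interleave_def)
next
  fix a b assume ab: "a \<in> carrier klein_wreath" "b \<in> carrier klein_wreath"
  obtain f n g k where [simp]: "a = (f, n)" "b = (g, k)" by force
  have parity: "(p + q) mod 2 = 1 \<longleftrightarrow> (p = 1) \<noteq> (q = 1)" if "p \<in> {0, 1}" "q \<in> {0, 1}" for p q :: int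
    using that by auto
  have *: "fst (f x) \<in> {0, 1}" "snd (f x) \<in> {0, 1}" "fst (g x) \<in> {0, 1}" "snd (g x) \<in> {0, 1}" for x
    using ab by simp_all
  show "interleave (a \<otimes>\<^bsub>klein_wreath\<^esub> b) = interleave a \<otimes>\<^bsub>lamplighter\<^esub> interleave b"
    by (simp add: interleave_def parity[OF *(1,3)] parity[OF *(2,4)] add.commute)
qed

lemma interleave_inj: "inj_on interleave (carrier klein_wreath)"
proof (rule inj_onI)
  fix a b assume ab: "a \<in> carrier klein_wreath" "b \<in> carrier klein_wreath" "interleave a = interleave b"
  obtain f n g k where [simp]: "a = (f, n)" "b = (g, k)" by force
  have eq: "(if even x then fst else snd) (f (x div 2)) = 1 \<longleftrightarrow> (if even x then fst else snd) (g (x div 2)) = 1" for x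
    using ab(3) by (auto simp: interleave_def set_eq_iff)
  have "f y = g y" for y
  proof -
    have "fst (f y) \<in> {0, 1}" "snd (f y) \<in> {0, 1}" "fst (g y) \<in> {0, 1}" "snd (g y) \<in> {0, 1}"
      using ab(1,2) by simp_all
    moreover have "fst (f y) = 1 \<longleftrightarrow> fst (g y) = 1" using eq[of "2 * y"] by simp
    moreover have "snd (f y) = 1 \<longleftrightarrow> snd (g y) = 1" using eq[of "2 * y + 1"] by simp
    ultimately show ?thesis by (auto simp: prod_eq_iff)
  qed
  then show "a = b" using ab(3) by (auto simp: interleave_def)
qed

section \<open>The extension of the wreath product by the coordinate swap\<close>

definition swap_action :: "int \<Rightarrow> (int \<Rightarrow> int \<times> int) \<times> int \<Rightarrow> (int \<Rightarrow> int \<times> int) \<times> int" where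
  "swap_action e = (\<lambda>(f, n). (\<lambda>x. if e = 0 then f x else prod.swap (f x), n))"

definition swap_extension :: "(((int \<Rightarrow> int \<times> int) \<times> int) \<times> int) monoid" where
  "swap_extension = semidirect_product klein_wreath (integer_mod_group 2) swap_action"

text \<open>Every nonzero \<open>e\<close> acts as the swap, an automorphism of \<open>klein\<close>
  applied pointwise, which commutes with translation.\<close>

lemma swap_action_hom: "swap_action e \<in> hom klein_wreath klein_wreath"
proof (rule homI)
  fix a assume a: "a \<in> carrier klein_wreath"
  obtain f n where f: "a = (f, n)" by force
  have "{x. (if e = 0 then f x else prod.swap (f x)) \<noteq> (0, 0)} = {x. f x \<noteq> (0, 0)}"
    by (auto simp: prod_eq_iff)
  then show "swap_action e a \<in> carrier klein_wreath"
    using a by (simp add: swap_action_def f)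
next
  fix a b :: "(int \<Rightarrow> int \<times> int) \<times> int"
  obtain f n g k where [simp]: "a = (f, n)" "b = (g, k)" by force
  show "swap_action e (a \<otimes>\<^bsub>klein_wreath\<^esub> b) = swap_action e a \<otimes>\<^bsub>klein_wreath\<^esub> swap_action e b"
    by (auto simp: swap_action_def)
qed

lemma group_swap_extension: "group swap_extension"
  unfolding swap_extension_def
proof (rule group_semidirect_product[OF group_klein_wreath _ swap_action_hom])
  fix e e' g assume "e \<in> carrier (integer_mod_group 2)" "e' \<in> carrier (integer_mod_group 2)"
  then show "swap_action (e \<otimes>\<^bsub>integer_mod_group 2\<^esub> e') g = swap_action e (swap_action e' g)"
    by (cases g) (auto simp: swap_action_def mult_integer_mod_group)
qed (auto simp: swap_action_def)

interpretation swap_extension: group swap_extension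
  by (rule group_swap_extension)

lemma swap_extension_carrier:
  "carrier swap_extension = carrier klein_wreath \<times> {0, 1}"
  by (simp add: swap_extension_def semidirect_product_def)

lemma swap_extension_mult:
  "(g, e) \<otimes>\<^bsub>swap_extension\<^esub> (g', e') = (g \<otimes>\<^bsub>klein_wreath\<^esub> swap_action e g', (e + e') mod 2)"
  by (simp add: swap_extension_def semidirect_product_def mult_integer_mod_group)

lemma swap_extension_one: "\<one>\<^bsub>swap_extension\<^esub> = (\<one>\<^bsub>klein_wreath\<^esub>, 0)"
  by (simp add: swap_extension_def semidirect_product_def)

lemma swap_action_0 [simp]: "swap_action 0 g = g"
  by (cases g) (simp add: swap_action_def)

lemma subgroup_klein_wreath: "subgroup (carrier klein_wreath \<times> {0}) swap_extension"
proof (rule swap_extension.subgroupI)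
  interpret G: group klein_wreath by (rule group_klein_wreath)
  show "carrier klein_wreath \<times> {0} \<subseteq> carrier swap_extension" by (auto simp: swap_extension_carrier)
  show "carrier klein_wreath \<times> {0::int} \<noteq> {}" using G.one_closed by blast
  fix a assume "a \<in> carrier klein_wreath \<times> {0::int}"
  then obtain g where g: "a = (g, 0)" "g \<in> carrier klein_wreath" by auto
  have "inv\<^bsub>swap_extension\<^esub> a = (inv\<^bsub>klein_wreath\<^esub> g, 0)"
    using g by (intro swap_extension.inv_equality)
      (auto simp: swap_extension_mult swap_extension_one swap_extension_carrier simp del: klein_wreath_one)
  then show "inv\<^bsub>swap_extension\<^esub> a \<in> carrier klein_wreath \<times> {0}" using g by simp
  fix b assume "b \<in> carrier klein_wreath \<times> {0::int}"
  then show "a \<otimes>\<^bsub>swap_extension\<^esub> b \<in> carrier klein_wreath \<times> {0}"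
    using g by (auto simp: swap_extension_mult simp del: klein_wreath_mult)
qed

lemma klein_wreath_iso:
  "klein_wreath \<cong> swap_extension\<lparr>carrier := carrier klein_wreath \<times> {0}\<rparr>"
proof (rule is_isoI)
  show "(\<lambda>g. (g, 0)) \<in> iso klein_wreath (swap_extension\<lparr>carrier := carrier klein_wreath \<times> {0}\<rparr>)"
    by (rule isoI) (auto simp: hom_def bij_betw_def inj_on_def swap_extension_mult)
qed

text \<open>The cosets are the two fibres of the projection to the swap exponent.\<close>

lemma card_rcosets_klein_wreath:
  "card (rcosets\<^bsub>swap_extension\<^esub> (carrier klein_wreath \<times> {0})) = 2"
proof -
  interpret G: group klein_wreath by (rule group_klein_wreath)
  let ?H = "carrier klein_wreath \<times> {0::int}"
  have coset: "?H #>\<^bsub>swap_extension\<^esub> (g, e) = carrier klein_wreath \<times> {e}"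
    if g: "g \<in> carrier klein_wreath" and e: "e \<in> {0, 1}" for g e
  proof -
    have "?H #>\<^bsub>swap_extension\<^esub> (g, e) = (\<lambda>h. (h \<otimes>\<^bsub>klein_wreath\<^esub> g, e)) ` carrier klein_wreath"
      using e by (auto simp: r_coset_def swap_extension_mult)
    also have "\<dots> = (carrier klein_wreath #>\<^bsub>klein_wreath\<^esub> g) \<times> {e}" by (auto simp: r_coset_def)
    also have "carrier klein_wreath #>\<^bsub>klein_wreath\<^esub> g = carrier klein_wreath"
      using G.coset_join2[OF g G.subgroup_self g] .
    finally show ?thesis .
  qed
  have "rcosets\<^bsub>swap_extension\<^esub> ?H = (\<lambda>(g, e). ?H #>\<^bsub>swap_extension\<^esub> (g, e)) ` (carrier klein_wreath \<times> {0, 1})"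
    unfolding RCOSETS_def swap_extension_carrier by blast
  also have "\<dots> = (\<lambda>(g, e). carrier klein_wreath \<times> {e}) ` (carrier klein_wreath \<times> {0, 1})"
    by (rule image_cong) (auto simp: coset)
  also have "\<dots> = {carrier klein_wreath \<times> {0}, carrier klein_wreath \<times> {1}}"
  proof -
    have eq: "(\<lambda>(g, e). carrier klein_wreath \<times> {e}) ` (carrier klein_wreath \<times> {0, 1::int}) =
        (\<lambda>e. carrier klein_wreath \<times> {e}) ` snd ` (carrier klein_wreath \<times> {0, 1})"
      by (simp only: image_image case_prod_unfold)
    show ?thesis unfolding eq snd_image_times using G.carrier_not_empty by simp
  qed
  finally have "rcosets\<^bsub>swap_extension\<^esub> ?H = {carrier klein_wreath \<times> {0}, carrier klein_wreath \<times> {1}}" .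
  moreover have "carrier klein_wreath \<times> {0::int} \<noteq> carrier klein_wreath \<times> {1}"
    using G.carrier_not_empty by (auto simp only: times_eq_iff)
  ultimately show ?thesis by simp
qed

text \<open>The inner final 0 is the translation, the outer one the swap exponent.\<close>

definition lamp :: "int \<Rightarrow> int \<times> int \<Rightarrow> ((int \<Rightarrow> int \<times> int) \<times> int) \<times> int" where
  "lamp k v = ((\<lambda>x. if x = k then v else (0, 0), 0), 0)"

lemma lamp_carrier:
  assumes "fst v \<in> {0, 1}" "snd v \<in> {0, 1}"
  shows "lamp k v \<in> carrier swap_extension"
proof -
  have "finite {x. x = k \<and> v \<noteq> (0, 0)}" by simp
  then show ?thesis
    using assms by (auto simp: lamp_def swap_extension_carrier)
qed

lemma not_property_LR_swap_extension: "\<not> property_LR swap_extension"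
proof -
  define x where "x = ((\<lambda>x::int. (0::int, 0::int), 0::int), 1::int)"
  define t where "t = ((\<lambda>x::int. (0::int, 0::int), 1::int), 0::int)"
  \<comment> \<open>\<open>x\<close> is the swap and \<open>t\<close> the unit translation. The lamp
    value \<open>(1, 1)\<close> is fixed by the swap, so all generators commute with
    \<open>x\<close>.\<close>
  define S where "S = {x, t, lamp 0 (1, 1)}"
  define H where "H = generate swap_extension S"
  have S: "S \<subseteq> carrier swap_extension"
    using lamp_carrier[of "(1, 1)" 0] by (auto simp: S_def x_def t_def swap_extension_carrier)
  interpret H: subgroup H swap_extension
    unfolding H_def by (rule swap_extension.generate_is_subgroup[OF S])
  have SH: "S \<subseteq> H" unfolding H_def by (auto intro: generate.incl)
  have inv_t: "inv\<^bsub>swap_extension\<^esub> t = ((\<lambda>x. (0, 0), - 1), 0)"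
    by (rule swap_extension.inv_equality)
      (auto simp: t_def swap_extension_carrier swap_extension_mult swap_extension_one)
  have inv_t_H: "inv\<^bsub>swap_extension\<^esub> t \<in> H" using SH by (auto simp: S_def)
  \<comment> \<open>Conjugation by \<open>t\<close> and by its inverse moves a lamp one step either
    way, so \<open>H\<close> contains the diagonal lamps at all positions.\<close>
  have shift: "inv\<^bsub>swap_extension\<^esub> t \<otimes>\<^bsub>swap_extension\<^esub> lamp k (1, 1) \<otimes>\<^bsub>swap_extension\<^esub> t = lamp (k + 1) (1, 1)"
    "t \<otimes>\<^bsub>swap_extension\<^esub> lamp k (1, 1) \<otimes>\<^bsub>swap_extension\<^esub> inv\<^bsub>swap_extension\<^esub> t = lamp (k - 1) (1, 1)" for k
    unfolding inv_t by (auto simp: t_def lamp_def swap_extension_mult fun_eq_iff)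
  have lamp_H: "lamp k (1, 1) \<in> H" for k
  proof (induction k rule: int_induct[where k = 0])
    case base
    then show ?case using SH by (simp add: S_def)
  next
    case (step1 i)
    then show ?case unfolding shift(1)[symmetric] using SH inv_t_H by (auto simp: S_def)
  next
    case (step2 i)
    then show ?case unfolding shift(2)[symmetric] using SH inv_t_H by (auto simp: S_def)
  qed
  have x: "x \<in> H" "x \<in> carrier swap_extension" using SH S by (auto simp: S_def)
  have central: "x \<otimes>\<^bsub>swap_extension\<^esub> h = h \<otimes>\<^bsub>swap_extension\<^esub> x" if "h \<in> H" for h
  proof -
    let ?C = "{h \<in> carrier swap_extension. x \<otimes>\<^bsub>swap_extension\<^esub> h = h \<otimes>\<^bsub>swap_extension\<^esub> x}"
    have "subgroup ?C swap_extension"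
      by (rule swap_extension.subgroup_centralizer[OF x(2)])
    moreover have "S \<subseteq> ?C"
      using S by (auto simp: S_def) (auto simp: x_def t_def lamp_def swap_extension_mult swap_action_def fun_eq_iff)
    ultimately have "H \<subseteq> ?C"
      unfolding H_def by (intro swap_extension.generate_subgroup_incl)
    then show ?thesis using that by blast
  qed
  have z: "lamp k (1, 0) \<in> carrier swap_extension" for k
    by (rule lamp_carrier) simp_all
  have inv_z: "inv\<^bsub>swap_extension\<^esub> lamp k (1, 0) = lamp k (1, 0)" for k
    by (rule swap_extension.inv_equality)
      (simp_all add: z, auto simp: lamp_def swap_extension_mult swap_extension_one fun_eq_iff)
  have "\<not> virtual_retract H swap_extension"
  proof (rule swap_extension.not_virtual_retract_if_commutators[OF x(1) central, where z = "\<lambda>k. lamp k (1, 0)"])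
    fix k l :: int
    let ?w = "lamp k (1, 0) \<otimes>\<^bsub>swap_extension\<^esub> inv\<^bsub>swap_extension\<^esub> lamp l (1, 0)"
    have "lamp k (1, 1) \<otimes>\<^bsub>swap_extension\<^esub> lamp l (1, 1) \<in> H" using lamp_H by blast
    \<comment> \<open>Swapping turns \<open>(1, 0)\<close> into \<open>(0, 1)\<close>, and the two
      differ by \<open>(1, 1)\<close>; the commutator is thus a product of diagonal lamps.\<close>
    moreover have "x \<otimes>\<^bsub>swap_extension\<^esub> ?w = lamp k (1, 1) \<otimes>\<^bsub>swap_extension\<^esub> lamp l (1, 1) \<otimes>\<^bsub>swap_extension\<^esub> (?w \<otimes>\<^bsub>swap_extension\<^esub> x)"
      unfolding inv_z by (auto simp: x_def lamp_def swap_extension_mult swap_action_def fun_eq_iff)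
    ultimately show "\<exists>h\<in>H. x \<otimes>\<^bsub>swap_extension\<^esub> ?w = h \<otimes>\<^bsub>swap_extension\<^esub> (?w \<otimes>\<^bsub>swap_extension\<^esub> x)" by blast
    assume "k \<noteq> l"
    then show "x \<otimes>\<^bsub>swap_extension\<^esub> ?w \<noteq> ?w \<otimes>\<^bsub>swap_extension\<^esub> x"
      \<comment> \<open>At position \<open>k\<close> the left side has value \<open>(0, 1)\<close>
        and the right side \<open>(1, 0)\<close>.\<close>
      unfolding inv_z by (auto simp: x_def lamp_def swap_extension_mult swap_action_def fun_eq_iff intro!: exI[of _ k])
  qed (use z in auto)
  moreover have "finitely_generated_subgroup H swap_extension"
    unfolding finitely_generated_subgroup_def H_def using S by (intro exI[of _ S]) (auto simp: S_def)
  ultimately show ?thesis by (auto simp: property_LR_def)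
qed

theorem proposition1p7:
  fixes G :: "((int \<Rightarrow> int \<times> int) \<times> int) monoid"
  assumes "G = restricted_wreath (integer_mod_group 2 \<times>\<times> integer_mod_group 2) integer_group"
  shows "property_LR G \<and>
    (\<exists>(Gt :: (((int \<Rightarrow> int \<times> int) \<times> int) \<times> int) monoid) H.
       group Gt \<and> subgroup H Gt \<and> G \<cong> Gt\<lparr>carrier := H\<rparr> \<and>
       card (rcosets\<^bsub>Gt\<^esub> H) = 2 \<and> \<not> property_LR Gt)"
proof
  show "property_LR G"
    unfolding assms
    by (rule property_LR_inj_hom[OF group_klein_wreath group_lamplighter interleave_hom
          interleave_inj property_LR_lamplighter])
  \<comment> \<open>The witness for \<open>H\<close> is the copy of \<open>G\<close> consisting of
    the pairs with swap exponent 0.\<close>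
  show "\<exists>(Gt :: (((int \<Rightarrow> int \<times> int) \<times> int) \<times> int) monoid) H.
       group Gt \<and> subgroup H Gt \<and> G \<cong> Gt\<lparr>carrier := H\<rparr> \<and>
       card (rcosets\<^bsub>Gt\<^esub> H) = 2 \<and> \<not> property_LR Gt"
    unfolding assms
    using group_swap_extension subgroup_klein_wreath klein_wreath_iso card_rcosets_klein_wreath
      not_property_LR_swap_extension
    by blast
qed

end
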